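(* Let $(\mathcal T_n)_{n\ge1}$ be a sequence of random finite trees, let $c_n$ be positive numbers and let $a\ge0$. Let $d_n$ be the graph distance in $\mathcal T_n$ and let, conditionally on $\mathcal T_n$, $(\xi^{(n)}_i)_i$ be i.i.d. uniformly random vertices of $\mathcal T_n$. Then the following are equivalent (as $n\to\infty$). (i) $c_n\mathcal T_n\to\Upsilon_a$ in probability. (ii) $c_nd_n(\xi^{(n)}_1,\xi^{(n)}_2)\to 2a$ in probability. (iii) For every $\varepsilon>0$, $\mathbb P\bigl[\,|c_nd_n(\xi^{(n)}_1,\xi^{(n)}_2)-2a|>\varepsilon\mid\mathcal T_n\bigr]\to0$ in probability.
   Context: $M_\infty$ is the Polish space of infinite real matrices $(a_{ij})_{i,j\ge1}$ with the product topology, and $\mathcal P(M_\infty)$ is the Polish space of Borel probability measures on it with the weak topology. For a finite tree $T$ and $c>0$, $\tau_\infty(cT)\in\mathcal P(M_\infty)$ is the distribution of $(c\,d_T(\xi_i,\xi_j)\mathbf 1\{i\ne j\})_{i,j\ge1}$, where $d_T$ is graph distance and $\xi_1,\xi_2,\dots$ are i.i.d. uniformly random vertices of $T$. $\Upsilon_a$ is the long dendron whose base is a one-point real tree and whose measure on $\{\bullet\}\times[0,\infty)\cong[0,\infty)$ is $\delta_a$; its sampling measure $\tau_\infty(\Upsilon_a)$ is the point mass at the constant matrix $(2a\mathbf 1\{i\ne j\})_{i,j\ge1}$. For random trees $\mathcal T_n$, "$c_n\mathcal T_n\to\Upsilon_a$ in probability" means that the random elements $\tau_\infty(c_n\mathcal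 T_n)$ of $\mathcal P(M_\infty)$ (the conditional distribution of the sampled distance matrix given $\mathcal T_n$) converge in probability to $\tau_\infty(\Upsilon_a)$. *)

theory Defs
  imports "HOL-Probability.Probability"
begin

text \<open>
  A graph is a pair of a vertex set and an edge set, the edges being given as an irreflexive
  symmetric relation.  Vertices are natural numbers; every finite tree is isomorphic to such a tree,
  and there are only countably many of these.
\<close>

type_synonym graph = "nat set \<times> (nat \<times> nat) set"

abbreviation verts :: "graph \<Rightarrow> nat set" where "verts \<equiv> fst"
abbreviation edges :: "graph \<Rightarrow> (nat \<times> nat) set" where "edges \<equiv> snd"

definition is_cycle :: "graph \<Rightarrow> nat list \<Rightarrow> bool" where
  "is_cycle G xs \<longleftrightarrow> length xs \<ge> 3 \<and> distinct xs \<and>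
     (\<forall>i<length xs. (xs ! i, xs ! (Suc i mod length xs)) \<in> edges G)"

definition finite_tree :: "graph \<Rightarrow> bool" where
  "finite_tree G \<longleftrightarrow>
     finite (verts G) \<and> verts G \<noteq> {} \<and>
     edges G \<subseteq> verts G \<times> verts G \<and> sym (edges G) \<and> irrefl (edges G) \<and>
     verts G \<times> verts G \<subseteq> (edges G)\<^sup>* \<and>
     (\<nexists>xs. is_cycle G xs)"

text \<open>The pairs in \<open>edges G ^^ k\<close> are the pairs joined by a walk with \<open>k\<close> edges.\<close>

definition graph_dist :: "graph \<Rightarrow> nat \<Rightarrow> nat \<Rightarrow> nat" where
  "graph_dist G u v = (LEAST k. (u, v) \<in> edges G ^^ k)"

text \<open>
  Infinite real matrices are functions of type \<open>nat \<Rightarrow> nat \<Rightarrow> real\<close>, indexed from 0, whose library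
  topology is the product topology; \<open>borel\<close> refers to that topology.
\<close>

definition tree_sampling :: "real \<Rightarrow> graph \<Rightarrow> (nat \<Rightarrow> nat \<Rightarrow> real) measure" where
  "tree_sampling c G =
     distr (\<Pi>\<^sub>M i\<in>(UNIV :: nat set). measure_pmf (pmf_of_set (verts G))) borel
       (\<lambda>\<xi> i j. c * real (graph_dist G (\<xi> i) (\<xi> j)) * of_bool (i \<noteq> j))"

text \<open>
  The sampling measure of a long dendron with base \<open>(B, d)\<close> and probability measure \<open>\<nu>\<close> on
  \<open>B \<times> [0, \<infinity>)\<close>: for i.i.d. points \<open>(x\<^sub>i, h\<^sub>i)\<close> with law \<open>\<nu>\<close> the off-diagonal entries are
  \<open>d x\<^sub>i x\<^sub>j + h\<^sub>i + h\<^sub>j\<close>.  It depends on the dendron only through \<open>d\<close> and \<open>\<nu>\<close>.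
\<close>

definition dendron_sampling ::
    "('b \<Rightarrow> 'b \<Rightarrow> real) \<Rightarrow> ('b \<times> real) measure \<Rightarrow> (nat \<Rightarrow> nat \<Rightarrow> real) measure" where
  "dendron_sampling d \<nu> =
     distr (\<Pi>\<^sub>M i\<in>(UNIV :: nat set). \<nu>) borel
       (\<lambda>p i j. (d (fst (p i)) (fst (p j)) + snd (p i) + snd (p j)) * of_bool (i \<noteq> j))"

text \<open>The sampling measure of \<open>\<Upsilon>\<^sub>a\<close>: the base is the one-point type \<open>unit\<close>, and \<open>\<nu> = \<delta>\<^sub>a\<close>.\<close>

definition Upsilon_sampling :: "real \<Rightarrow> (nat \<Rightarrow> nat \<Rightarrow> real) measure" where
  "Upsilon_sampling a =
     dendron_sampling (\<lambda>_ _. 0) (return (count_space (UNIV :: unit set) \<Otimes>\<^sub>M borel) ((), a))"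

lemma matrix_measurable:
  fixes f :: "'a \<Rightarrow> nat \<Rightarrow> nat \<Rightarrow> real"
  assumes "\<And>i j. (\<lambda>x. f x i j) \<in> borel_measurable M"
  shows "f \<in> borel_measurable M"
  by (intro measurable_coordinatewise_then_product assms)

lemma tree_sampling_in_prob_algebra: "tree_sampling c G \<in> space (prob_algebra borel)"
proof -
  let ?P = "\<Pi>\<^sub>M i\<in>(UNIV :: nat set). measure_pmf (pmf_of_set (verts G))"
  interpret P: product_prob_space "\<lambda>_::nat. measure_pmf (pmf_of_set (verts G))" UNIV ..
  have comp: "(\<lambda>\<xi>. \<xi> i) \<in> measurable ?P (count_space UNIV)" for i :: nat
    using measurable_component_singleton[of i UNIV "\<lambda>_. measure_pmf (pmf_of_set (verts G))"]
    by simp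
  have "(\<lambda>\<xi>. (\<xi> i, \<xi> j)) \<in> measurable ?P (count_space UNIV)" for i j :: nat
    using measurable_Pair[OF comp[of i] comp[of j]]
    by (simp add: pair_measure_countable)
  from measurable_compose[OF this, where g = "\<lambda>(u, v). real (graph_dist G u v)" and L = borel]
  have "(\<lambda>\<xi>. real (graph_dist G (\<xi> i) (\<xi> j))) \<in> borel_measurable ?P" for i j :: nat
    by simp
  then have "(\<lambda>\<xi> i j. c * real (graph_dist G (\<xi> i) (\<xi> j)) * of_bool (i \<noteq> j))
      \<in> borel_measurable ?P"
    by (intro matrix_measurable) (intro borel_measurable_times; simp)
  then show ?thesis
    by (simp add: tree_sampling_def space_prob_algebra P.prob_space_distr)
qed

lemma Upsilon_sampling_eq: "Upsilon_sampling a = return borel (\<lambda>i j. 2 * a * of_bool (i \<noteq> j))"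
proof -
  let ?N = "count_space (UNIV :: unit set) \<Otimes>\<^sub>M (borel :: real measure)"
  let ?P = "\<Pi>\<^sub>M i\<in>(UNIV :: nat set). return ?N ((), a)"
  let ?g = "\<lambda>(p :: nat \<Rightarrow> unit \<times> real) i j. (0 + snd (p i) + snd (p j)) * of_bool (i \<noteq> j)"
  have pr: "prob_space (return ?N ((), a))"
    by (intro prob_space_return) (simp add: space_pair_measure)
  interpret P: product_prob_space "\<lambda>_::nat. return ?N ((), a)" UNIV
    using pr by (simp add: product_prob_space_def product_prob_space_axioms_def
        product_sigma_finite_def prob_space_imp_sigma_finite)
  have c: "(\<lambda>p. snd (p i)) \<in> borel_measurable ?P" for i :: nat
  proof -
    have "(\<lambda>p. p i) \<in> measurable ?P ?N"
      using measurable_component_singleton[of i UNIV "\<lambda>_. return ?N ((), a)"] by simp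
    then show ?thesis by (rule measurable_compose) simp
  qed
  have g: "?g \<in> borel_measurable ?P"
    by (intro matrix_measurable borel_measurable_times borel_measurable_add c) simp_all
  have ae1: "AE p in ?P. snd (p i) = a" for i :: nat
  proof -
    have "AE x in return ?N ((), a). snd x = a"
      by (subst AE_return) (simp_all add: space_pair_measure)
    then show ?thesis
      using P.AE_component[of i "\<lambda>x. snd x = a"] by simp
  qed
  have ae: "AE p in ?P. ?g p = (\<lambda>i j. 2 * a * of_bool (i \<noteq> j))"
  proof -
    have "AE p in ?P. \<forall>i. snd (p i) = a" using ae1 by (simp add: AE_all_countable)
    then show ?thesis by eventually_elim (auto simp: fun_eq_iff)
  qed
  have "Upsilon_sampling a = distr ?P borel ?g"
    by (simp add: Upsilon_sampling_def dendron_sampling_def)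
  also have "\<dots> = distr ?P borel (\<lambda>_. (\<lambda>i j. 2 * a * of_bool (i \<noteq> j)))"
    by (rule distr_cong_AE[OF refl refl ae g]) simp
  also have "\<dots> = return borel (\<lambda>i j. 2 * a * of_bool (i \<noteq> j))"
    by (rule P.distr_const) simp
  finally show ?thesis .
qed

text \<open>
  The coarsest topology on the Borel probability measures that makes \<open>\<mu> \<mapsto> \<integral>f d\<mu>\<close> continuous for
  every bounded continuous \<open>f\<close>.
\<close>

definition weak_topology :: "'b::topological_space measure topology" where
  "weak_topology = topology_generated_by
     {{\<mu> \<in> space (prob_algebra borel). (\<integral>x. f x \<partial>\<mu>) \<in> U} | (f :: 'b \<Rightarrow> real) U.
        continuous_on UNIV f \<and> bounded (range f) \<and> open U}"

lemma topspace_weak_topology: "topspace weak_topology = space (prob_algebra borel)"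
proof -
  have "space (prob_algebra borel) \<in>
    {{\<mu> \<in> space (prob_algebra borel). (\<integral>x. f x \<partial>\<mu>) \<in> U} | (f :: 'b::topological_space \<Rightarrow> real) U.
        continuous_on UNIV f \<and> bounded (range f) \<and> open U}"
    by (rule CollectI, rule exI[of _ "\<lambda>_. 0"], rule exI[of _ UNIV]) auto
  then show ?thesis unfolding weak_topology_def topology_generated_by_topspace by auto
qed

text \<open>
  Convergence in probability to a constant, in the form that does not depend on a choice of metric.
\<close>

definition conv_in_prob ::
    "'b topology \<Rightarrow> (nat \<Rightarrow> 'a measure) \<Rightarrow> (nat \<Rightarrow> 'a \<Rightarrow> 'b) \<Rightarrow> 'b \<Rightarrow> bool" where
  "conv_in_prob \<T> M X x \<longleftrightarrow>
     (\<forall>U. openin \<T> U \<and> x \<in> U \<longrightarrow>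
        (\<lambda>n. measure (M n) {\<omega> \<in> space (M n). X n \<omega> \<notin> U}) \<longlonglongrightarrow> 0)"

lemma conv_in_prob_metric:
  fixes X :: "nat \<Rightarrow> 'a \<Rightarrow> 'b::{metric_space, second_countable_topology}"
  assumes "\<And>n. prob_space (M n)" and meas: "\<And>n. X n \<in> borel_measurable (M n)"
  shows "conv_in_prob euclidean M X x \<longleftrightarrow>
    (\<forall>e>0. (\<lambda>n. measure (M n) {\<omega> \<in> space (M n). dist (X n \<omega>) x > e}) \<longlonglongrightarrow> 0)"
    (is "?L \<longleftrightarrow> ?R")
proof
  assume L: ?L
  show ?R
  proof (intro allI impI)
    fix e :: real assume e: "e > 0"
    have lim: "(\<lambda>n. measure (M n) {\<omega> \<in> space (M n). X n \<omega> \<notin> ball x e}) \<longlonglongrightarrow> 0"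
      using L[unfolded conv_in_prob_def, rule_format, of "ball x e"] e by simp
    have le: "measure (M n) {\<omega> \<in> space (M n). dist (X n \<omega>) x > e}
        \<le> measure (M n) {\<omega> \<in> space (M n). X n \<omega> \<notin> ball x e}" for n
    proof -
      interpret prob_space "M n" by fact
      note meas[of n, measurable]
      show ?thesis by (rule finite_measure_mono) (auto simp: dist_commute)
    qed
    show "(\<lambda>n. measure (M n) {\<omega> \<in> space (M n). dist (X n \<omega>) x > e}) \<longlonglongrightarrow> 0"
      by (rule tendsto_sandwich[OF _ _ tendsto_const lim]) (use le in auto)
  qed
next
  assume R: ?R
  show ?L unfolding conv_in_prob_def
  proof (intro allI impI)
    fix U assume "openin euclidean U \<and> x \<in> U"
    then have U: "open U" "x \<in> U" by auto
    then obtain e where e: "e > 0" "ball x e \<subseteq> U" by (meson openE)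
    have lim: "(\<lambda>n. measure (M n) {\<omega> \<in> space (M n). dist (X n \<omega>) x > e / 2}) \<longlonglongrightarrow> 0"
      using R[rule_format, of "e / 2"] e by simp
    have sub: "{\<omega> \<in> space (M n). X n \<omega> \<notin> U} \<subseteq> {\<omega> \<in> space (M n). dist (X n \<omega>) x > e / 2}" for n
    proof -
      have "y \<in> U" if "dist y x \<le> e / 2" for y
        using that e by (auto simp: dist_commute intro!: subsetD[OF e(2)])
      then show ?thesis by (auto simp: not_le[symmetric])
    qed
    have le: "measure (M n) {\<omega> \<in> space (M n). X n \<omega> \<notin> U}
        \<le> measure (M n) {\<omega> \<in> space (M n). dist (X n \<omega>) x > e / 2}" for n
    proof -
      interpret prob_space "M n" by fact
      note meas[of n, measurable]
      show ?thesis by (rule finite_measure_mono[OF sub]) measurable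
    qed
    show "(\<lambda>n. measure (M n) {\<omega> \<in> space (M n). X n \<omega> \<notin> U}) \<longlonglongrightarrow> 0"
      by (rule tendsto_sandwich[OF _ _ tendsto_const lim]) (use le in auto)
  qed
qed

abbreviation tree_space :: "graph measure" where
  "tree_space \<equiv> count_space {G. finite_tree G}"

text \<open>
  A random tree \<open>T\<close> takes countably many values, so conditioning on \<open>T\<close> means conditioning on each
  event \<open>T = t\<close> of positive probability.
\<close>

definition cond_iid_uniform_verts ::
    "'a measure \<Rightarrow> ('a \<Rightarrow> graph) \<Rightarrow> (nat \<Rightarrow> 'a \<Rightarrow> nat) \<Rightarrow> bool" where
  "cond_iid_uniform_verts M T \<xi> \<longleftrightarrow>
     (\<forall>i. \<xi> i \<in> measurable M (count_space UNIV)) \<and>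
     (\<forall>t. let E = {\<omega> \<in> space M. T \<omega> = t} in
        measure M E > 0 \<longrightarrow>
          prob_space.indep_vars (uniform_measure M E) (\<lambda>_. count_space UNIV) \<xi> UNIV \<and>
          (\<forall>i. distr (uniform_measure M E) (count_space UNIV) (\<xi> i)
                 = measure_pmf (pmf_of_set (verts t))))"

definition cond_prob_given_tree ::
    "'a measure \<Rightarrow> ('a \<Rightarrow> graph) \<Rightarrow> 'a set \<Rightarrow> 'a \<Rightarrow> real" where
  "cond_prob_given_tree M T A =
     real_cond_exp M (vimage_algebra (space M) T tree_space) (indicator A)"

end

theory Submission
  imports Defs
begin

text \<open>
  All three conditions are equivalent to \<open>P(\<bar>c\<^sub>n d\<^sub>n(\<xi>\<^sub>1, \<xi>\<^sub>2) - 2a\<bar> > \<epsilon>) \<longlonglongrightarrow> 0\<close> for every \<open>\<epsilon> > 0\<close>.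
  This probability is the expectation of the conditional one, which lies in \<open>[0, 1]\<close>, and for such
  variables convergence to 0 in mean and in probability agree.  On the side of the sampling measures,
  the limit is a point mass: testing against \<open>min 1 (\<bar>A\<^sub>0\<^sub>1 - 2a\<bar> / \<epsilon>)\<close> detects the conditional
  probability, and conversely a neighbourhood of a point in the product topology restricts only
  finitely many entries, each off-diagonal one having the law of \<open>c\<^sub>n d\<^sub>n(\<xi>\<^sub>1, \<xi>\<^sub>2)\<close>, so a union bound
  controls every integral of a bounded continuous function.
\<close>

section \<open>Laws of pairs of independent variables\<close>

text \<open>The two measures agree on rectangles, where independence factors the joint probability,
  and both marginals are sigma-finite, so agreement on rectangles suffices.\<close>

lemma (in prob_space) distr_pair_indep_vars:
  assumes indep: "indep_vars N X I" and ij: "i \<in> I" "j \<in> I" "i \<noteq> j"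
  shows "distr M (N i \<Otimes>\<^sub>M N j) (\<lambda>\<omega>. (X i \<omega>, X j \<omega>)) = distr M (N i) (X i) \<Otimes>\<^sub>M distr M (N j) (X j)"
proof (rule pair_measure_eqI[symmetric])
  have [measurable]: "X i \<in> measurable M (N i)" "X j \<in> measurable M (N j)"
    using indep ij by (auto simp: indep_vars_def)
  show "sigma_finite_measure (distr M (N i) (X i))" "sigma_finite_measure (distr M (N j) (X j))"
    by (simp_all add: prob_space_distr prob_space_imp_sigma_finite)
  show "sets (distr M (N i) (X i) \<Otimes>\<^sub>M distr M (N j) (X j))
      = sets (distr M (N i \<Otimes>\<^sub>M N j) (\<lambda>\<omega>. (X i \<omega>, X j \<omega>)))"
    by (simp cong: sets_pair_measure_cong)
  fix A B assume "A \<in> sets (distr M (N i) (X i))" "B \<in> sets (distr M (N j) (X j))"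
  then have [measurable]: "A \<in> sets (N i)" "B \<in> sets (N j)" by simp_all
  \<comment> \<open>Independence of the family is applied to the index set \<open>{i, j}\<close>; as
    \<open>i \<noteq> j\<close>, the conditional selects \<open>A\<close> at \<open>i\<close> and
    \<open>B\<close> at \<open>j\<close>.\<close>
  have "prob (\<Inter>k\<in>{i, j}. X k -` (if k = i then A else B) \<inter> space M)
      = (\<Prod>k\<in>{i, j}. prob (X k -` (if k = i then A else B) \<inter> space M))"
    using ij by (intro indep_varsD[OF indep]) auto
  then have "prob ((X i -` A \<inter> space M) \<inter> (X j -` B \<inter> space M))
      = prob (X i -` A \<inter> space M) * prob (X j -` B \<inter> space M)"
    using ij(3) by auto
  moreover have "(\<lambda>\<omega>. (X i \<omega>, X j \<omega>)) -` (A \<times> B) \<inter> space M = (X i -` A \<inter> space M) \<inter> (X j -` B \<inter> space M)"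
    by auto
  ultimately show "emeasure (distr M (N i) (X i)) A * emeasure (distr M (N j) (X j)) B
      = emeasure (distr M (N i \<Otimes>\<^sub>M N j) (\<lambda>\<omega>. (X i \<omega>, X j \<omega>))) (A \<times> B)"
    by (simp add: emeasure_distr emeasure_eq_measure ennreal_mult)
qed

text \<open>Meant for two settings: the vertices under the law conditioned on the tree, and the
  coordinates of the infinite product behind \<open>tree_sampling\<close>. Both then give the same
  number. The predicate \<open>P\<close> may be arbitrary because the product of two countable
  discrete spaces is discrete.\<close>

lemma (in prob_space) prob_pair_indep_vars:
  assumes indep: "indep_vars (\<lambda>_. count_space (UNIV :: nat set)) X I" and ij: "i \<in> I" "j \<in> I" "i \<noteq> j"
    and d: "\<And>k. k \<in> I \<Longrightarrow> distr M (count_space UNIV) (X k) = measure_pmf p"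
  shows "measure M {\<omega> \<in> space M. P (X i \<omega>) (X j \<omega>)}
    = measure (measure_pmf p \<Otimes>\<^sub>M measure_pmf p) {(u, v). P u v}"
proof -
  have [measurable]: "X k \<in> measurable M (count_space UNIV)" if "k \<in> I" for k
    using indep that by (auto simp: indep_vars_def)
  have "(count_space (UNIV :: nat set) \<Otimes>\<^sub>M count_space (UNIV :: nat set)) = count_space UNIV"
    by (simp add: pair_measure_countable)
  then have [simp]: "sets (count_space (UNIV :: nat set) \<Otimes>\<^sub>M count_space (UNIV :: nat set)) = UNIV"
    by (metis Pow_UNIV sets_count_space)
  have "measure (measure_pmf p \<Otimes>\<^sub>M measure_pmf p) {(u, v). P u v}
    = measure (distr M (count_space UNIV \<Otimes>\<^sub>M count_space UNIV) (\<lambda>\<omega>. (X i \<omega>, X j \<omega>))) {(u, v). P u v}"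
    using distr_pair_indep_vars[OF indep ij] d ij by simp
  also have "\<dots> = measure M ((\<lambda>\<omega>. (X i \<omega>, X j \<omega>)) -` {(u, v). P u v} \<inter> space M)"
    using ij measurable_Pair[of "X i" M "count_space UNIV" "X j" "count_space UNIV"]
    by (intro measure_distr) simp_all
  also have "\<dots> = measure M {\<omega> \<in> space M. P (X i \<omega>) (X j \<omega>)}"
    by (rule arg_cong[where f = "measure M"]) auto
  finally show ?thesis by simp
qed

lemma finite_tree_countable: "countable {G. finite_tree G}"
proof (rule countable_subset)
  show "{G. finite_tree G} \<subseteq> Collect finite \<times> Collect finite"
  proof safe
    fix V E assume t: "finite_tree (V, E)"
    show "finite V" using t by (simp add: finite_tree_def)
    have "finite (V \<times> V)" "E \<subseteq> V \<times> V" using t by (simp_all add: finite_tree_def)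
    then show "finite E" by (rule finite_subset[rotated])
  qed
  show "countable (Collect finite \<times> Collect finite :: graph set)"
    by (intro countable_SIGMA countable_Collect_finite)
qed

section \<open>Neighbourhoods in the product topology\<close>

lemma open_fun_nbhd:
  fixes U :: "('i \<Rightarrow> 'b::topological_space) set"
  assumes "open U" "x \<in> U"
  shows "\<exists>I Y. finite I \<and> (\<forall>i. open (Y i) \<and> x i \<in> Y i) \<and> (\<forall>y. (\<forall>i\<in>I. y i \<in> Y i) \<longrightarrow> y \<in> U)"
proof -
  have "openin (product_topology (\<lambda>i. euclidean) UNIV) U"
    using assms(1) unfolding open_fun_def .
  from product_topology_open_contains_basis[OF this assms(2)]
  obtain Y where Y: "x \<in> (\<Pi>\<^sub>E i\<in>UNIV. Y i)" "\<And>i. open (Y i)" "finite {i. Y i \<noteq> UNIV}"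
    "(\<Pi>\<^sub>E i\<in>UNIV. Y i) \<subseteq> U" by auto
  have "y \<in> U" if "\<forall>i\<in>{i. Y i \<noteq> UNIV}. y i \<in> Y i" for y
  proof -
    have "y i \<in> Y i" for i using that by (cases "Y i = UNIV") auto
    then show ?thesis using Y(4) by auto
  qed
  with Y(1-3) show ?thesis by (intro exI[of _ "{i. Y i \<noteq> UNIV}"] exI[of _ Y]) auto
qed

text \<open>The product topology is unpacked twice, first over the rows and then inside each
  restricted row, which leaves a finite set \<open>K\<close> of restricted positions. Finiteness
  gives one radius for all of them. The closed form \<open>\<le> d\<close> makes failure at a
  position the event \<open>> d\<close>, as in \<open>far_prob\<close>.\<close>

lemma open_matrix_nbhd:
  fixes U :: "(nat \<Rightarrow> nat \<Rightarrow> real) set"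
  assumes "open U" "L \<in> U"
  obtains K d where "finite K" "d > 0"
    "\<And>A. (\<And>i j. (i, j) \<in> K \<Longrightarrow> \<bar>A i j - L i j\<bar> \<le> d) \<Longrightarrow> A \<in> U"
proof -
  from open_fun_nbhd[OF assms] obtain I Y where
    "finite I" "\<forall>i. open (Y i) \<and> L i \<in> Y i" "\<forall>y. (\<forall>i\<in>I. y i \<in> Y i) \<longrightarrow> y \<in> U"
    by (elim exE conjE)
  then have Y: "finite I" "\<And>i. open (Y i)" "\<And>i. L i \<in> Y i"
    "\<And>y. \<forall>i\<in>I. y i \<in> Y i \<Longrightarrow> y \<in> U"
    by simp_all
  have "\<exists>J Z. finite J \<and> (\<forall>j. open (Z j) \<and> L i j \<in> Z j) \<and> (\<forall>y. (\<forall>j\<in>J. y j \<in> Z j) \<longrightarrow> y \<in> Y i)" for i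
    by (rule open_fun_nbhd[OF Y(2)[of i] Y(3)])
  \<comment> \<open>Both witnesses are packed into a pair, so that one application of choice
    provides them for all rows.\<close>
  then have "\<forall>i. \<exists>JZ. finite (fst JZ) \<and> (\<forall>j. open (snd JZ j) \<and> L i j \<in> snd JZ j) \<and>
      (\<forall>y. (\<forall>j\<in>fst JZ. y j \<in> snd JZ j) \<longrightarrow> y \<in> Y i)"
    by simp
  from choice[OF this] obtain JZ where JZ: "\<And>i. finite (fst (JZ i)) \<and> (\<forall>j. open (snd (JZ i) j) \<and> L i j \<in> snd (JZ i) j) \<and>
      (\<forall>y. (\<forall>j\<in>fst (JZ i). y j \<in> snd (JZ i) j) \<longrightarrow> y \<in> Y i)"
    by blast
  define J Z where "J i = fst (JZ i)" and "Z i = snd (JZ i)" for i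
  have Z: "\<And>i. finite (J i)" "\<And>i j. open (Z i j)" "\<And>i j. L i j \<in> Z i j"
    "\<And>i y. \<forall>j\<in>J i. y j \<in> Z i j \<Longrightarrow> y \<in> Y i"
    using JZ by (simp_all add: J_def Z_def)
  define K where "K = Sigma I J"
  have fin: "finite K" using Y(1) Z(1) by (simp add: K_def)
  have "\<forall>\<^sub>F d in at_right 0. \<forall>k\<in>K. cball (L (fst k) (snd k)) d \<subseteq> Z (fst k) (snd k)"
  proof (rule eventually_ball_finite[OF fin], rule ballI)
    fix k
    obtain e where e: "e > 0" "cball (L (fst k) (snd k)) e \<subseteq> Z (fst k) (snd k)"
      using Z(2)[of "fst k" "snd k"] Z(3)[of "fst k" "snd k"] unfolding open_contains_cball by auto
    have "cball (L (fst k) (snd k)) d \<subseteq> Z (fst k) (snd k)" if "d < e" for d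
      using subset_cball[OF less_imp_le[OF that]] e(2) by (rule subset_trans)
    then show "\<forall>\<^sub>F d in at_right 0. cball (L (fst k) (snd k)) d \<subseteq> Z (fst k) (snd k)"
      by (rule eventually_at_rightI[OF _ e(1)]) simp
  qed
  then obtain b where b: "b > 0"
    "\<forall>d>0. d < b \<longrightarrow> (\<forall>k\<in>K. cball (L (fst k) (snd k)) d \<subseteq> Z (fst k) (snd k))"
    unfolding eventually_at_right_field by auto
  define d where "d = b / 2"
  have d: "d > 0" "\<And>k. k \<in> K \<Longrightarrow> cball (L (fst k) (snd k)) d \<subseteq> Z (fst k) (snd k)"
    using b by (simp_all add: d_def)
  show ?thesis
  proof (rule that[OF fin d(1)])
    fix A assume A: "\<And>i j. (i, j) \<in> K \<Longrightarrow> \<bar>A i j - L i j\<bar> \<le> d"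
    have "A i j \<in> Z i j" if "(i, j) \<in> K" for i j
    proof -
      have "A i j \<in> cball (L i j) d" using A[OF that] by (simp add: dist_real_def abs_minus_commute)
      then show ?thesis using d(2)[OF that] by auto
    qed
    then show "A \<in> U" by (intro Y(4) Z(4) ballI) (simp add: K_def)
  qed
qed

section \<open>Convergence in probability and in mean on the unit interval\<close>

text \<open>Markov's inequality bounds the tail by the mean, and splitting at a level
  \<open>e\<close> bounds the mean by \<open>e\<close> plus the tail. The bounds on
  \<open>X n\<close> are required only almost everywhere, since conditional probabilities are
  determined only up to null sets.\<close>

lemma conv_in_prob_zero_iff_expectation:
  fixes X :: "nat \<Rightarrow> 'a \<Rightarrow> real"
  assumes pr: "\<And>n. prob_space (M n)" and meas: "\<And>n. X n \<in> borel_measurable (M n)"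
    and bd: "\<And>n. AE \<omega> in M n. 0 \<le> X n \<omega> \<and> X n \<omega> \<le> 1"
  shows "conv_in_prob euclidean M X 0 \<longleftrightarrow> (\<lambda>n. \<integral>\<omega>. X n \<omega> \<partial>M n) \<longlonglongrightarrow> 0"
proof -
  define R where "R n e = measure (M n) {\<omega> \<in> space (M n). \<bar>X n \<omega>\<bar> > e}" for n e
  define E where "E n = (\<integral>\<omega>. X n \<omega> \<partial>M n)" for n
  have E0: "E n \<ge> 0" for n
    unfolding E_def using bd[of n] by (intro integral_nonneg_AE) auto
  have int: "integrable (M n) (X n)" for n
  proof -
    interpret prob_space "M n" by fact
    show ?thesis using bd[of n] meas[of n] by (intro integrable_const_bound[of _ 1]) auto
  qed
  have upper: "R n e \<le> E n / e" if "e > 0" for n e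
  proof -
    interpret prob_space "M n" by fact
    note meas[of n, measurable]
    have "R n e \<le> measure (M n) {\<omega> \<in> space (M n). X n \<omega> \<ge> e}"
      unfolding R_def using bd[of n] that
      by (intro finite_measure_mono_AE) (auto elim!: eventually_mono)
    also have "\<dots> \<le> E n / e"
      unfolding E_def using bd[of n] that int[of n]
      by (intro integral_Markov_inequality_measure[where A = "{}"]) auto
    finally show ?thesis .
  qed
  \<comment> \<open>Off the tail event the variable is at most \<open>e\<close>, on it at most
    1.\<close>
  have lower: "E n \<le> e + R n e" if "e > 0" for n e
  proof -
    interpret prob_space "M n" by fact
    note meas[of n, measurable]
    have "E n \<le> (\<integral>\<omega>. e + indicator {\<omega> \<in> space (M n). \<bar>X n \<omega>\<bar> > e} \<omega> \<partial>M n)"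
      unfolding E_def
    proof (intro integral_mono_AE int)
      show "AE \<omega> in M n. X n \<omega> \<le> e + indicator {\<omega> \<in> space (M n). \<bar>X n \<omega>\<bar> > e} \<omega>"
        using bd[of n] AE_space by eventually_elim (use that in \<open>auto simp: indicator_def\<close>)
      show "integrable (M n) (\<lambda>\<omega>. e + indicator {\<omega> \<in> space (M n). \<bar>X n \<omega>\<bar> > e} \<omega> :: real)"
        by (intro integrable_const_bound[of _ "e + 1"]) (use that in \<open>auto simp: indicator_def\<close>)
    qed
    also have "\<dots> = e + R n e"
      by (subst Bochner_Integration.integral_add) (auto simp: R_def prob_space intro!: integrable_const_bound[of _ 1])
    finally show ?thesis .
  qed
  have "conv_in_prob euclidean M X 0 \<longleftrightarrow> (\<forall>e>0. (\<lambda>n. R n e) \<longlonglongrightarrow> 0)"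
    using conv_in_prob_metric[OF pr meas] by (simp add: R_def)
  also have "\<dots> \<longleftrightarrow> E \<longlonglongrightarrow> 0"
  proof safe
    fix e :: real assume "E \<longlonglongrightarrow> 0" "e > 0"
    then have "(\<lambda>n. E n / e) \<longlonglongrightarrow> 0" by (intro tendsto_divide_zero)
    then show "(\<lambda>n. R n e) \<longlonglongrightarrow> 0"
      by (rule tendsto_sandwich[OF _ _ tendsto_const, rotated 2])
         (use upper \<open>e > 0\<close> in \<open>auto simp: R_def\<close>)
  next
    assume R: "\<forall>e>0. (\<lambda>n. R n e) \<longlonglongrightarrow> 0"
    show "E \<longlonglongrightarrow> 0"
    proof (rule tendstoI)
      fix e :: real assume e: "e > 0"
      then have "\<forall>\<^sub>F n in sequentially. R n (e / 2) < e / 2"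
        using R[rule_format, of "e / 2"] by (intro order_tendstoD(2)[where y = 0]) auto
      then show "\<forall>\<^sub>F n in sequentially. dist (E n) 0 < e"
      proof eventually_elim
        case (elim n)
        then show ?case using lower[of "e / 2" n] E0[of n] e by simp
      qed
    qed
  qed
  finally show ?thesis unfolding E_def .
qed

section \<open>Conditional probability given the tree\<close>

lemma subalgebra_tree:
  assumes T: "T \<in> measurable M tree_space"
  shows "subalgebra M (vimage_algebra (space M) T tree_space)"
proof -
  have "T \<in> space M \<rightarrow> space tree_space" using measurable_space[OF T] by auto
  then show ?thesis
    by (auto simp: subalgebra_def sets_vimage_algebra2 intro: measurable_sets[OF T])
qed

lemma (in prob_space) integral_cond_prob_given_tree:
  assumes T: "T \<in> measurable M tree_space" and A: "A \<in> sets M"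
  shows "(\<integral>\<omega>. cond_prob_given_tree M T A \<omega> \<partial>M) = prob A"
proof -
  interpret finite_measure_subalgebra M "vimage_algebra (space M) T tree_space"
    by unfold_locales (rule subalgebra_tree[OF T])
  have "integrable M (indicator A :: 'a \<Rightarrow> real)"
    using A by (intro integrable_real_indicator) (simp_all add: less_top[symmetric])
  from real_cond_exp_int(2)[OF this] A show ?thesis
    by (simp add: cond_prob_given_tree_def)
qed

text \<open>A function measurable for the sigma-algebra generated by \<open>T\<close> is constant on
  each atom \<open>T = t\<close>. Integrating over an atom of positive probability identifies the
  constant as \<open>g t\<close>; the remaining atoms are countably many null sets.\<close>

lemma (in prob_space) cond_prob_given_tree_AE:
  assumes T[measurable]: "T \<in> measurable M tree_space" and A[measurable]: "A \<in> sets M"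
    and g: "\<And>t. prob {\<omega> \<in> space M. T \<omega> = t} > 0 \<Longrightarrow>
      prob (A \<inter> {\<omega> \<in> space M. T \<omega> = t}) = g t * prob {\<omega> \<in> space M. T \<omega> = t}"
  shows "AE \<omega> in M. cond_prob_given_tree M T A \<omega> = g (T \<omega>)"
proof -
  let ?F = "vimage_algebra (space M) T tree_space"
  let ?E = "\<lambda>t. {\<omega> \<in> space M. T \<omega> = t}"
  have TF: "T \<in> space M \<rightarrow> space tree_space" using measurable_space[OF T] by auto
  have setsF: "sets ?F = {T -` S \<inter> space M |S. S \<in> sets tree_space}"
    by (rule sets_vimage_algebra2[OF TF])
  interpret finite_measure_subalgebra M ?F
    by unfold_locales (rule subalgebra_tree[OF T])
  have ET: "?E t \<in> sets ?F" if "finite_tree t" for t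
    unfolding setsF using that by (intro CollectI exI[of _ "{t}"]) auto
  have E[measurable]: "?E t \<in> sets M" if "finite_tree t" for t
    using ET[OF that] subalg by (auto simp: subalgebra_def)
  have cmeas: "cond_prob_given_tree M T A \<in> borel_measurable ?F"
    by (simp add: cond_prob_given_tree_def)
  \<comment> \<open>The level set through \<open>\<omega>\<close> is a preimage under
    \<open>T\<close>, so it contains the whole fibre of \<open>T\<close> through
    \<open>\<omega>\<close>.\<close>
  have const: "cond_prob_given_tree M T A \<omega> = cond_prob_given_tree M T A \<omega>'"
    if "\<omega> \<in> space M" "\<omega>' \<in> space M" "T \<omega> = T \<omega>'" for \<omega> \<omega>'
  proof -
    have "cond_prob_given_tree M T A -` {cond_prob_given_tree M T A \<omega>} \<inter> space ?F \<in> sets ?F"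
      by (intro measurable_sets[OF cmeas]) simp
    then obtain S where "cond_prob_given_tree M T A -` {cond_prob_given_tree M T A \<omega>} \<inter> space M = T -` S \<inter> space M"
      unfolding setsF by auto
    moreover have "\<omega> \<in> cond_prob_given_tree M T A -` {cond_prob_given_tree M T A \<omega>} \<inter> space M"
      using that by simp
    ultimately have "\<omega>' \<in> cond_prob_given_tree M T A -` {cond_prob_given_tree M T A \<omega>} \<inter> space M"
      using that by auto
    then show ?thesis by simp
  qed
  \<comment> \<open>The defining property of conditional expectation equates the integrals of the
    indicator and of the conditional probability over the atom. Constancy takes the latter out of
    the integral, and the positive probability of the atom cancels.\<close>
  have eq: "cond_prob_given_tree M T A \<omega> = g (T \<omega>)" if \<omega>: "\<omega> \<in> space M" and pos: "prob (?E (T \<omega>)) > 0" for \<omega>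
  proof -
    have t: "finite_tree (T \<omega>)" using TF \<omega> by auto
    have "g (T \<omega>) * prob (?E (T \<omega>)) = prob (A \<inter> ?E (T \<omega>))" by (rule g[OF pos, symmetric])
    also have "\<dots> = (\<integral>x\<in>?E (T \<omega>). indicator A x \<partial>M)"
      using E[OF t] by (simp add: set_lebesgue_integral_def indicator_inter_arith[symmetric] Int_commute)
    also have "\<dots> = (\<integral>x\<in>?E (T \<omega>). cond_prob_given_tree M T A x \<partial>M)"
      unfolding cond_prob_given_tree_def by (intro real_cond_exp_intA ET t integrable_real_indicator A) (simp add: less_top[symmetric])
    also have "\<dots> = (\<integral>x\<in>?E (T \<omega>). cond_prob_given_tree M T A \<omega> \<partial>M)"
      using \<omega> E[OF t] by (intro set_lebesgue_integral_cong) (auto intro!: const)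
    also have "\<dots> = cond_prob_given_tree M T A \<omega> * prob (?E (T \<omega>))"
      using E[OF t] by (simp add: set_lebesgue_integral_def)
    finally show ?thesis using pos by simp
  qed
  define N where "N = {t. finite_tree t \<and> prob (?E t) = 0}"
  have "(\<Union>t\<in>N. ?E t) \<in> null_sets M"
  proof (rule null_sets_UN')
    show "countable N" using finite_tree_countable by (rule countable_subset[rotated]) (auto simp: N_def)
    fix t assume "t \<in> N"
    then show "?E t \<in> null_sets M" by (intro null_setsI) (simp_all add: N_def emeasure_eq_measure E)
  qed
  then show ?thesis
  proof (rule AE_I')
    show "{\<omega> \<in> space M. cond_prob_given_tree M T A \<omega> \<noteq> g (T \<omega>)} \<subseteq> (\<Union>t\<in>N. ?E t)"
      using eq TF by (fastforce simp: N_def zero_less_measure_iff)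
  qed
qed

section \<open>Probability that two uniform vertices have a distance far from the limit\<close>

text \<open>A deterministic function of the tree. Evaluated at the random tree it is a version of
  the conditional probability in the third condition, and it is also the tail of an off-diagonal
  entry under the sampling measure, so it links the conditions.\<close>

definition far_prob :: "real \<Rightarrow> real \<Rightarrow> real \<Rightarrow> graph \<Rightarrow> real" where
  "far_prob c a e t = measure (measure_pmf (pmf_of_set (verts t)) \<Otimes>\<^sub>M measure_pmf (pmf_of_set (verts t)))
     {(u, v). \<bar>c * real (graph_dist t u v) - 2 * a\<bar> > e}"

lemma far_prob_bounds: "0 \<le> far_prob c a e t" "far_prob c a e t \<le> 1"
proof -
  interpret pair_prob_space "measure_pmf (pmf_of_set (verts t))" "measure_pmf (pmf_of_set (verts t))" ..
  show "0 \<le> far_prob c a e t" "far_prob c a e t \<le> 1" by (simp_all add: far_prob_def)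
qed

text \<open>Conditionally on \<open>T = t\<close> the two vertices are independent and uniform on
  \<open>t\<close>, and on that event \<open>T \<omega>\<close> may be replaced by \<open>t\<close>.
  This has the form of the premise on \<open>g\<close> in
  \<open>cond_prob_given_tree_AE\<close>.\<close>

lemma (in prob_space) prob_far_given_tree:
  assumes \<xi>: "cond_iid_uniform_verts M T \<xi>" and pos: "prob {\<omega> \<in> space M. T \<omega> = t} > 0"
  shows "prob ({\<omega> \<in> space M. \<bar>c * real (graph_dist (T \<omega>) (\<xi> 0 \<omega>) (\<xi> 1 \<omega>)) - 2 * a\<bar> > e}
      \<inter> {\<omega> \<in> space M. T \<omega> = t}) = far_prob c a e t * prob {\<omega> \<in> space M. T \<omega> = t}"
proof -
  let ?E = "{\<omega> \<in> space M. T \<omega> = t}"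
  let ?B = "{\<omega> \<in> space M. \<bar>c * real (graph_dist t (\<xi> 0 \<omega>) (\<xi> 1 \<omega>)) - 2 * a\<bar> > e}"
  \<comment> \<open>A set outside the sigma-algebra has measure 0 by convention, so positivity
    forces measurability.\<close>
  have E: "?E \<in> sets M" using pos measure_notin_sets[of ?E M] by (cases "?E \<in> sets M") simp_all
  have [measurable]: "\<xi> i \<in> measurable M (count_space UNIV)" for i
    using \<xi> by (simp add: cond_iid_uniform_verts_def)
  interpret U: prob_space "uniform_measure M ?E"
    using pos by (intro prob_space_uniform_measure) (simp_all add: emeasure_eq_measure)
  have iid: "U.indep_vars (\<lambda>_. count_space UNIV) \<xi> UNIV"
    "distr (uniform_measure M ?E) (count_space UNIV) (\<xi> k) = measure_pmf (pmf_of_set (verts t))" for k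
    using \<xi>[unfolded cond_iid_uniform_verts_def Let_def, THEN conjunct2, rule_format, OF pos] by simp_all
  have "far_prob c a e t = U.prob {\<omega> \<in> space (uniform_measure M ?E). \<bar>c * real (graph_dist t (\<xi> 0 \<omega>) (\<xi> 1 \<omega>)) - 2 * a\<bar> > e}"
    unfolding far_prob_def
    by (rule U.prob_pair_indep_vars[OF iid(1) _ _ _ iid(2), symmetric, of 0 1
          "\<lambda>u v. \<bar>c * real (graph_dist t u v) - 2 * a\<bar> > e"]) simp_all
  also have "\<dots> = U.prob ?B" by simp
  also have "\<dots> = prob (?E \<inter> ?B) / prob ?E"
    using pos E by (intro measure_uniform_measure) (auto simp: emeasure_eq_measure)
  also have "?E \<inter> ?B = {\<omega> \<in> space M. \<bar>c * real (graph_dist (T \<omega>) (\<xi> 0 \<omega>) (\<xi> 1 \<omega>)) - 2 * a\<bar> > e} \<inter> ?E"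
    by auto
  finally show ?thesis using pos by simp
qed

section \<open>Entries and integrals of the sampling measure\<close>

lemma continuous_on_matrix_entry: "continuous_on UNIV (\<lambda>A :: nat \<Rightarrow> nat \<Rightarrow> real. A i j)"
proof -
  have "continuous_on UNIV (\<lambda>A :: nat \<Rightarrow> nat \<Rightarrow> real. A i)" by simp
  from continuous_on_product_then_coordinatewise[OF this] show ?thesis .
qed

lemma measurable_matrix_entry [measurable]:
  "(\<lambda>A. A i j) \<in> borel_measurable (borel :: (nat \<Rightarrow> nat \<Rightarrow> real) measure)"
  by (rule borel_measurable_continuous_onI[OF continuous_on_matrix_entry])

lemma measure_tree_sampling_entry:
  assumes "i \<noteq> j"
  shows "measure (tree_sampling c t) {A. \<bar>A i j - 2 * a\<bar> > e} = far_prob c a e t"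
proof -
  let ?p = "measure_pmf (pmf_of_set (verts t))"
  let ?P = "\<Pi>\<^sub>M i\<in>(UNIV :: nat set). ?p"
  interpret P: product_prob_space "\<lambda>_::nat. ?p" UNIV ..
  have comp: "(\<lambda>x. x i) \<in> measurable ?P (count_space UNIV)" for i :: nat
    using measurable_component_singleton[of i UNIV "\<lambda>_. ?p"] by simp
  have pair: "(\<lambda>x. (x i, x j)) \<in> measurable ?P (count_space UNIV)" for i j :: nat
    using measurable_Pair[OF comp[of i] comp[of j]] by (simp add: pair_measure_countable)
  have distr: "distr ?P (count_space UNIV) (\<lambda>x. x k) = ?p" for k :: nat
  proof -
    have "distr ?P (count_space UNIV) (\<lambda>x. x k) = distr ?P ?p (\<lambda>x. x k)" by (intro distr_cong) simp_all
    also have "\<dots> = ?p" using P.PiM_component[of k] by simp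
    finally show ?thesis .
  qed
  \<comment> \<open>Independence is read off from the joint law: the family of all coordinates is
    the identity map, whose law is the product measure itself.\<close>
  have "distr ?P (PiM UNIV (\<lambda>_. count_space UNIV)) (\<lambda>x. x) = ?P"
    by (rule distr_id2) (intro sets_PiM_cong refl, simp)
  then have indep: "P.indep_vars (\<lambda>_. count_space UNIV) (\<lambda>k x. x k) UNIV"
    using comp by (subst P.indep_vars_iff_distr_eq_PiM') (simp_all add: distr restrict_UNIV)
  have "(\<lambda>x i j. c * real (graph_dist t (x i) (x j)) * of_bool (i \<noteq> j)) \<in> borel_measurable ?P"
  proof (intro matrix_measurable)
    fix i j
    show "(\<lambda>x. c * real (graph_dist t (x i) (x j)) * of_bool (i \<noteq> j)) \<in> borel_measurable ?P"
      using measurable_compose[OF pair[of i j], where L = borel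
          and g = "\<lambda>(u, v). c * real (graph_dist t u v) * of_bool (i \<noteq> j)"] by simp
  qed
  then have "measure (tree_sampling c t) {A. \<bar>A i j - 2 * a\<bar> > e}
    = measure ?P {x \<in> space ?P. \<bar>c * real (graph_dist t (x i) (x j)) - 2 * a\<bar> > e}"
    unfolding tree_sampling_def using assms
    by (subst measure_distr) (auto intro!: arg_cong[where f = "measure ?P"])
  also have "\<dots> = far_prob c a e t"
    unfolding far_prob_def
    using assms P.prob_pair_indep_vars[OF indep _ _ _ distr, of i j
        "\<lambda>u v. \<bar>c * real (graph_dist t u v) - 2 * a\<bar> > e"] by simp
  finally show ?thesis .
qed

text \<open>Diagonal entries are identically 0, so the event has empty preimage. Hence diagonal
  positions add nothing to the union bound over restricted entries.\<close>

lemma measure_tree_sampling_diagonal: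
  assumes "e \<ge> 0"
  shows "measure (tree_sampling c t) {A. \<bar>A i i\<bar> > e} = 0"
proof -
  let ?P = "\<Pi>\<^sub>M i\<in>(UNIV :: nat set). measure_pmf (pmf_of_set (verts t))"
  let ?f = "\<lambda>x i j. c * real (graph_dist t (x i) (x j)) * of_bool (i \<noteq> j)"
  have "?f -` {A. \<bar>A i i\<bar> > e} = {}" using assms by auto
  \<comment> \<open>Unfolding \<open>distr\<close> leaves either the measure of the empty preimage
    or the default value of \<open>measure_of\<close>; both are 0.\<close>
  then show ?thesis unfolding tree_sampling_def measure_def distr_def
    by (simp add: emeasure_measure_of_conv)
qed

text \<open>The point is uniformity: \<open>d\<close> and \<open>k\<close> serve all
  \<open>c\<close> and \<open>t\<close> at once. By continuity at the limit matrix, \<open>f\<close>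
  moves by less than \<open>e\<close> unless one of finitely many entries is off by more than
  \<open>d\<close>; in that case it moves by at most \<open>2 * B\<close>. A union bound over the
  positions gives \<open>k = 2 * B * card K\<close>.\<close>

lemma tree_sampling_integral_bound:
  fixes f :: "(nat \<Rightarrow> nat \<Rightarrow> real) \<Rightarrow> real"
  assumes f: "continuous_on UNIV f" and bd: "\<And>A. \<bar>f A\<bar> \<le> B" and e: "e > 0"
  obtains d k where "d > 0" "k \<ge> 0"
    "\<And>c t. \<bar>(\<integral>A. f A \<partial>tree_sampling c t) - f (\<lambda>i j. 2 * a * of_bool (i \<noteq> j))\<bar> \<le> e + k * far_prob c a d t"
proof -
  define L where "L = (\<lambda>i j :: nat. 2 * a * of_bool (i \<noteq> j))"
  have "open (f -` ball (f L) e)" using f by (intro open_vimage) auto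
  moreover have "L \<in> f -` ball (f L) e" using e by simp
  ultimately obtain K d where K: "finite K" "d > 0"
    "\<And>A. (\<And>i j. (i, j) \<in> K \<Longrightarrow> \<bar>A i j - L i j\<bar> \<le> d) \<Longrightarrow> A \<in> f -` ball (f L) e"
    by (rule open_matrix_nbhd) blast
  have B: "B \<ge> 0" using bd[of L] by linarith
  define Bad where "Bad = (\<lambda>k. {A. \<bar>A (fst k) (snd k) - L (fst k) (snd k)\<bar> > d})"
  define bad where "bad = (\<Union>k\<in>K. Bad k)"
  have Bad[measurable]: "Bad k \<in> sets borel" for k unfolding Bad_def by measurable
  have bad[measurable]: "bad \<in> sets borel" using K(1) unfolding bad_def by (intro sets.finite_UN) auto
  have close: "\<bar>f A - f L\<bar> \<le> e + 2 * B * indicator bad A" for A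
  proof (cases "A \<in> bad")
    case True
    then show ?thesis using bd[of A] bd[of L] e by simp
  next
    case False
    then have "A \<in> f -` ball (f L) e" by (intro K(3)) (force simp: bad_def Bad_def not_less)
    then show ?thesis using False by (simp add: dist_real_def abs_minus_commute)
  qed
  have "\<bar>(\<integral>A. f A \<partial>tree_sampling c t) - f L\<bar> \<le> e + 2 * B * card K * far_prob c a d t" for c t
  proof -
    let ?\<mu> = "tree_sampling c t"
    interpret prob_space ?\<mu> using tree_sampling_in_prob_algebra[of c t] by (simp add: space_prob_algebra)
    have sets[measurable_cong, simp]: "sets ?\<mu> = sets borel" by (simp add: tree_sampling_def)
    have [measurable]: "f \<in> borel_measurable borel" by (rule borel_measurable_continuous_onI[OF f])
    have int: "integrable ?\<mu> f" by (rule integrable_const_bound[of _ B]) (use bd in auto)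
    have "(\<integral>A. f A \<partial>?\<mu>) - f L = (\<integral>A. f A - f L \<partial>?\<mu>)" using int by (simp add: prob_space)
    also have "\<bar>\<dots>\<bar> \<le> (\<integral>A. \<bar>f A - f L\<bar> \<partial>?\<mu>)" by (rule integral_abs_bound)
    also have "\<dots> \<le> (\<integral>A. e + 2 * B * indicator bad A \<partial>?\<mu>)"
      using int close by (intro integral_mono) (auto intro!: integrable_real_indicator simp: less_top[symmetric])
    also have "\<dots> = e + 2 * B * prob bad"
      by (subst Bochner_Integration.integral_add) (auto simp: prob_space less_top[symmetric] intro!: integrable_real_indicator)
    finally have "\<bar>(\<integral>A. f A \<partial>?\<mu>) - f L\<bar> \<le> e + 2 * B * prob bad" .
    moreover have "prob bad \<le> (\<Sum>k\<in>K. prob (Bad k))"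
      unfolding bad_def by (rule finite_measure_subadditive_finite[OF K(1)]) auto
    \<comment> \<open>An off-diagonal position contributes exactly \<open>far_prob c a d t\<close>;
      a diagonal one contributes 0, as the limit matrix vanishes there too.\<close>
    moreover have "\<dots> \<le> (\<Sum>k\<in>K. far_prob c a d t)"
    proof (rule sum_mono)
      fix k
      show "prob (Bad k) \<le> far_prob c a d t"
        using measure_tree_sampling_entry[of "fst k" "snd k" c t d a]
          measure_tree_sampling_diagonal[of d c t "fst k"] far_prob_bounds(1)[of c a d t] K(2)
        by (cases "fst k = snd k") (auto simp: Bad_def L_def)
    qed
    ultimately have "prob bad \<le> card K * far_prob c a d t" by simp
    then have "2 * B * prob bad \<le> 2 * B * (card K * far_prob c a d t)"
      using B by (intro mult_left_mono) simp_all
    with \<open>\<bar>(\<integral>A. f A \<partial>?\<mu>) - f L\<bar> \<le> e + 2 * B * prob bad\<close> show ?thesis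
      by (simp add: mult.assoc)
  qed
  then show thesis using that[of d "2 * B * card K"] K(2) B by (simp add: L_def)
qed

section \<open>Convergence of the random sampling measures\<close>

text \<open>The space of trees is discrete, so every property of the random tree is an event,
  including membership of its sampling measure in a weakly open set.\<close>

lemma measurable_tree_pred:
  assumes "T \<in> measurable M tree_space"
  shows "{\<omega> \<in> space M. P (T \<omega>)} \<in> sets M"
proof -
  have "{\<omega> \<in> space M. P (T \<omega>)} = T -` {t. finite_tree t \<and> P t} \<inter> space M"
    using measurable_space[OF assms] by auto
  also have "\<dots> \<in> sets M" by (rule measurable_sets[OF assms]) auto
  finally show ?thesis .
qed

lemma conv_in_prob_tree_sampling_iff:
  assumes pr: "\<And>n. prob_space (M n)" and T: "\<And>n. T n \<in> measurable (M n) tree_space"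
  shows "conv_in_prob weak_topology M (\<lambda>n \<omega>. tree_sampling (c n) (T n \<omega>)) (Upsilon_sampling a)
    \<longleftrightarrow> (\<forall>e>0. conv_in_prob euclidean M (\<lambda>n \<omega>. far_prob (c n) a e (T n \<omega>)) 0)"
    (is "?L \<longleftrightarrow> ?R")
proof -
  let ?C = "\<lambda>i j :: nat. 2 * a * of_bool (i \<noteq> j)"
  define P where "P n Q = measure (M n) {\<omega> \<in> space (M n). Q (T n \<omega>)}" for n Q
  have P_mono: "P n Q \<le> P n Q'" if "\<And>t. Q t \<Longrightarrow> Q' t" for n Q Q'
  proof -
    interpret prob_space "M n" by fact
    show ?thesis unfolding P_def
      by (intro finite_measure_mono measurable_tree_pred T Collect_mono) (use that in blast)
  qed
  have P_0: "P n Q \<ge> 0" for n Q by (simp add: P_def)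
  have P_squeeze: "(\<lambda>n. P n (Q n)) \<longlonglongrightarrow> 0" if "\<And>n. P n (Q n) \<le> b n" "b \<longlonglongrightarrow> 0" for Q b
    by (rule tendsto_sandwich[OF _ _ tendsto_const that(2)]) (simp_all add: P_0 that(1))
  have P_lim: "(\<lambda>n. P n (Q n)) \<longlonglongrightarrow> 0" if "\<And>n t. Q n t \<Longrightarrow> Q' n t" "(\<lambda>n. P n (Q' n)) \<longlonglongrightarrow> 0" for Q Q'
    using P_mono[OF that(1)] that(2) by (rule P_squeeze)
  have meas: "(\<lambda>\<omega>. far_prob (c n) a e (T n \<omega>)) \<in> borel_measurable (M n)" for n e
    by (rule measurable_compose[OF T]) simp
  have R_iff: "?R \<longleftrightarrow> (\<forall>d>0. \<forall>e>0. (\<lambda>n. P n (\<lambda>t. far_prob (c n) a d t > e)) \<longlonglongrightarrow> 0)"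
    using conv_in_prob_metric[of M, OF pr meas] by (simp add: P_def far_prob_bounds(1))
  have L_iff: "?L \<longleftrightarrow> (\<forall>U. openin weak_topology U \<and> return borel ?C \<in> U \<longrightarrow>
      (\<lambda>n. P n (\<lambda>t. tree_sampling (c n) t \<notin> U)) \<longlonglongrightarrow> 0)"
    by (simp add: conv_in_prob_def P_def Upsilon_sampling_eq)
  have return_in: "return borel ?C \<in> space (prob_algebra borel)"
    by (simp add: space_prob_algebra prob_space_return)
  show ?thesis unfolding L_iff R_iff
  proof (intro iffI allI impI)
    fix d e :: real
    assume L: "\<forall>U. openin weak_topology U \<and> return borel ?C \<in> U \<longrightarrow>
        (\<lambda>n. P n (\<lambda>t. tree_sampling (c n) t \<notin> U)) \<longlonglongrightarrow> 0"
      and d: "d > 0" and e: "e > 0"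
    define f :: "(nat \<Rightarrow> nat \<Rightarrow> real) \<Rightarrow> real" where "f = (\<lambda>A. min 1 (\<bar>A 0 1 - 2 * a\<bar> / d))"
    \<comment> \<open>The limit is a point mass at a matrix where \<open>f\<close> vanishes, so it
      lies in \<open>U\<close>. Since \<open>f\<close> dominates the indicator of a deviation beyond
      \<open>d\<close>, a tree with \<open>far_prob\<close> above \<open>e\<close> has its sampling
      measure outside \<open>U\<close>.\<close>
    define U where "U = {\<mu> \<in> space (prob_algebra borel). (\<integral>x. f x \<partial>\<mu>) \<in> {..<e}}"
    have f: "continuous_on UNIV f" unfolding f_def using d by (intro continuous_intros continuous_on_matrix_entry) auto
    have bd: "0 \<le> f A" "f A \<le> 1" for A using d by (auto simp: f_def)
    have "bounded (range f)" by (rule boundedI[of _ 1]) (use bd in auto)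
    then have "openin weak_topology U"
      unfolding weak_topology_def U_def using f
      by (intro topology_generated_by_Basis CollectI exI[of _ f] exI[of _ "{..<e}"]) auto
    moreover have [measurable]: "f \<in> borel_measurable borel" by (rule borel_measurable_continuous_onI[OF f])
    have "return borel ?C \<in> U"
      using return_in e by (simp add: U_def integral_return) (simp add: f_def)
    ultimately have lim: "(\<lambda>n. P n (\<lambda>t. tree_sampling (c n) t \<notin> U)) \<longlonglongrightarrow> 0" using L by blast
    show "(\<lambda>n. P n (\<lambda>t. far_prob (c n) a d t > e)) \<longlonglongrightarrow> 0"
    proof (rule P_lim[OF _ lim])
      fix n t assume far: "far_prob (c n) a d t > e"
      let ?\<mu> = "tree_sampling (c n) t"
      interpret prob_space ?\<mu> using tree_sampling_in_prob_algebra[of "c n" t] by (simp add: space_prob_algebra)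
      have [measurable_cong, simp]: "sets ?\<mu> = sets borel" by (simp add: tree_sampling_def)
      have "far_prob (c n) a d t = prob {A. \<bar>A 0 1 - 2 * a\<bar> > d}"
        by (simp add: measure_tree_sampling_entry)
      also have "\<dots> = (\<integral>A. indicator {A. \<bar>A 0 1 - 2 * a\<bar> > d} A \<partial>?\<mu>)" by simp
      also have "\<dots> \<le> (\<integral>A. f A \<partial>?\<mu>)"
        using d bd by (intro integral_mono integrable_const_bound[of _ 1])
          (auto simp: f_def indicator_def field_simps)
      finally show "?\<mu> \<notin> U" using far by (simp add: U_def)
    qed
  next
    fix U
    assume R: "\<forall>d>0. \<forall>e>0. (\<lambda>n. P n (\<lambda>t. far_prob (c n) a d t > e)) \<longlonglongrightarrow> 0"
      and U: "openin weak_topology U \<and> return borel ?C \<in> U"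
    from U have "generate_topology_on
      {{\<mu> \<in> space (prob_algebra borel). (\<integral>x. f x \<partial>\<mu>) \<in> U} | (f :: (nat \<Rightarrow> nat \<Rightarrow> real) \<Rightarrow> real) U.
        continuous_on UNIV f \<and> bounded (range f) \<and> open U} U"
      unfolding weak_topology_def by (intro openin_topology_generated_by) simp
    \<comment> \<open>Induction on the generation of \<open>U\<close> from subbasic sets, carrying
      along that the limit belongs to the set. Intersections use subadditivity, unions a single
      member containing the limit, and subbasic sets the integral bound.\<close>
    then show "(\<lambda>n. P n (\<lambda>t. tree_sampling (c n) t \<notin> U)) \<longlonglongrightarrow> 0" using conjunct2[OF U]
    proof induction
      case Empty
      then show ?case by simp
    next
      case (Int U V)
      have "P n (\<lambda>t. tree_sampling (c n) t \<notin> U \<inter> V)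
          \<le> P n (\<lambda>t. tree_sampling (c n) t \<notin> U) + P n (\<lambda>t. tree_sampling (c n) t \<notin> V)" for n
      proof -
        interpret prob_space "M n" by fact
        have "P n (\<lambda>t. tree_sampling (c n) t \<notin> U \<inter> V)
          = prob ({\<omega> \<in> space (M n). tree_sampling (c n) (T n \<omega>) \<notin> U} \<union> {\<omega> \<in> space (M n). tree_sampling (c n) (T n \<omega>) \<notin> V})"
          unfolding P_def by (rule arg_cong[where f = prob]) auto
        also have "\<dots> \<le> P n (\<lambda>t. tree_sampling (c n) t \<notin> U) + P n (\<lambda>t. tree_sampling (c n) t \<notin> V)"
          unfolding P_def by (intro measure_Un_le measurable_tree_pred T)
        finally show ?thesis .
      qed
      moreover have "(\<lambda>n. P n (\<lambda>t. tree_sampling (c n) t \<notin> U) + P n (\<lambda>t. tree_sampling (c n) t \<notin> V)) \<longlonglongrightarrow> 0"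
        using Int.prems by (intro tendsto_add_zero Int.IH) simp_all
      ultimately show ?case by (rule P_squeeze)
    next
      case (UN K)
      then obtain V where "V \<in> K" "return borel ?C \<in> V" by auto
      then show ?case by (intro P_lim[OF _ UN.IH[of V]]) blast+
    next
      case (Basis S)
      then obtain f :: "(nat \<Rightarrow> nat \<Rightarrow> real) \<Rightarrow> real" and V where
        S: "S = {\<mu> \<in> space (prob_algebra borel). (\<integral>x. f x \<partial>\<mu>) \<in> V}"
        and f: "continuous_on UNIV f" "bounded (range f)" and V: "open V" by auto
      obtain B where B: "\<And>A. \<bar>f A\<bar> \<le> B" using f(2) by (auto simp: bounded_iff)
      have [measurable]: "f \<in> borel_measurable borel" by (rule borel_measurable_continuous_onI[OF f(1)])
      have "f ?C \<in> V" using Basis(2) by (simp add: S integral_return)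
      then obtain e where e: "e > 0" "ball (f ?C) e \<subseteq> V" using V openE by metis
      obtain d k where d: "d > 0" "k \<ge> 0" and
        le: "\<And>c t. \<bar>(\<integral>A. f A \<partial>tree_sampling c t) - f ?C\<bar> \<le> e / 2 + k * far_prob c a d t"
        using tree_sampling_integral_bound[OF f(1) B, of "e / 2" a] e(1) by auto
      \<comment> \<open>Leaving the ball of radius \<open>e\<close> forces
        \<open>e / 2 \<le> (k + 1) * far_prob\<close>, hence \<open>far_prob\<close> at least
        \<open>2 * r\<close>, which exceeds \<open>r\<close>. The factor \<open>k + 1\<close> keeps
        the denominator positive when \<open>k = 0\<close>.\<close>
      define r where "r = e / (4 * (k + 1))"
      have r: "r > 0" using e(1) d(2) by (simp add: r_def)
      show ?case
      proof (rule P_lim[where Q' = "\<lambda>n t. far_prob (c n) a d t > r"])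
        show "(\<lambda>n. P n (\<lambda>t. far_prob (c n) a d t > r)) \<longlonglongrightarrow> 0" using R d(1) r by blast
      next
        fix n t assume t: "tree_sampling (c n) t \<notin> S"
        then have "(\<integral>A. f A \<partial>tree_sampling (c n) t) \<notin> ball (f ?C) e"
          using e(2) tree_sampling_in_prob_algebra[of "c n" t] by (auto simp: S)
        then have "e \<le> e / 2 + k * far_prob (c n) a d t"
          using le[of "c n" t] by (simp add: dist_real_def abs_minus_commute)
        moreover have "k * far_prob (c n) a d t \<le> (k + 1) * far_prob (c n) a d t"
          using far_prob_bounds(1) by (intro mult_right_mono) auto
        ultimately have "e / 2 \<le> (k + 1) * far_prob (c n) a d t" by linarith
        then have "2 * r \<le> far_prob (c n) a d t" using d(2) by (simp add: r_def field_simps)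
        then show "far_prob (c n) a d t > r" using r by linarith
      qed
    qed
  qed
qed

section \<open>Equivalence of the three conditions\<close>

theorem theorem8p2:
  fixes M :: "nat \<Rightarrow> 'a measure"
    and T :: "nat \<Rightarrow> 'a \<Rightarrow> graph"
    and \<xi> :: "nat \<Rightarrow> nat \<Rightarrow> 'a \<Rightarrow> nat"
    and c :: "nat \<Rightarrow> real" and a :: real
  assumes "\<And>n. prob_space (M n)"
    and "\<And>n. T n \<in> measurable (M n) tree_space"
    and "\<And>n. cond_iid_uniform_verts (M n) (T n) (\<xi> n)"
    and "\<And>n. c n > 0" and "a \<ge> 0"
  defines "D \<equiv> \<lambda>n \<omega>. c n * real (graph_dist (T n \<omega>) (\<xi> n 0 \<omega>) (\<xi> n 1 \<omega>))"
  defines "conv_trees \<equiv>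
      conv_in_prob weak_topology M (\<lambda>n \<omega>. tree_sampling (c n) (T n \<omega>)) (Upsilon_sampling a)"
    and "conv_dist \<equiv> conv_in_prob euclidean M D (2 * a)"
    and "conv_cond \<equiv> \<forall>\<epsilon>>0.
      conv_in_prob euclidean M
        (\<lambda>n. cond_prob_given_tree (M n) (T n) {\<omega> \<in> space (M n). \<bar>D n \<omega> - 2 * a\<bar> > \<epsilon>}) 0"
  shows "(conv_trees \<longleftrightarrow> conv_dist) \<and> (conv_dist \<longleftrightarrow> conv_cond)"
proof -
  note pr = assms(1) and T = assms(2) and iid = assms(3)
  define A where "A n e = {\<omega> \<in> space (M n). \<bar>D n \<omega> - 2 * a\<bar> > e}" for n e
  have Dmeas: "D n \<in> borel_measurable (M n)" for n
  proof -
    have xi: "\<xi> n i \<in> measurable (M n) (count_space UNIV)" for i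
      using iid[of n] by (simp add: cond_iid_uniform_verts_def)
    \<comment> \<open>Measurability is shown for a fixed tree and then glued over the countably many
      values of \<open>T n\<close>.\<close>
    have "(\<lambda>\<omega>. c n * real (graph_dist t (\<xi> n 0 \<omega>) (\<xi> n 1 \<omega>))) \<in> borel_measurable (M n)" for t
      using xi by measurable
    then show ?thesis
      unfolding D_def by (rule measurable_compose_countable'[OF _ T finite_tree_countable])
  qed
  have A: "A n e \<in> sets (M n)" for n e
    unfolding A_def using Dmeas[of n] by measurable
  have ce: "AE \<omega> in M n. cond_prob_given_tree (M n) (T n) (A n e) \<omega> = far_prob (c n) a e (T n \<omega>)" for n e
  proof (rule prob_space.cond_prob_given_tree_AE[OF pr T A])
    fix t
    assume "measure (M n) {\<omega> \<in> space (M n). T n \<omega> = t} > 0"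
    from prob_space.prob_far_given_tree[OF pr iid this, of e "c n" a]
    show "measure (M n) (A n e \<inter> {\<omega> \<in> space (M n). T n \<omega> = t})
        = far_prob (c n) a e t * measure (M n) {\<omega> \<in> space (M n). T n \<omega> = t}"
      by (simp add: A_def D_def)
  qed
  have cmeas: "cond_prob_given_tree (M n) (T n) (A n e) \<in> borel_measurable (M n)" for n e
    by (simp add: cond_prob_given_tree_def)
  have fmeas: "(\<lambda>\<omega>. far_prob (c n) a e (T n \<omega>)) \<in> borel_measurable (M n)" for n e
    by (rule measurable_compose[OF T]) simp
  have Ecp: "(\<integral>\<omega>. cond_prob_given_tree (M n) (T n) (A n e) \<omega> \<partial>M n) = measure (M n) (A n e)" for n e
    by (rule prob_space.integral_cond_prob_given_tree[OF pr T A])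
  \<comment> \<open>Almost everywhere equal to the conditional probability, \<open>far_prob\<close>
    at the random tree has the same mean, namely the unconditional probability of
    \<open>A n e\<close>.\<close>
  have Efar: "(\<integral>\<omega>. far_prob (c n) a e (T n \<omega>) \<partial>M n) = measure (M n) (A n e)" for n e
    using integral_cong_AE[OF cmeas fmeas ce, of n e] Ecp by simp
  have far: "conv_in_prob euclidean M (\<lambda>n \<omega>. far_prob (c n) a e (T n \<omega>)) 0
      \<longleftrightarrow> (\<lambda>n. measure (M n) (A n e)) \<longlonglongrightarrow> 0" for e
    using conv_in_prob_zero_iff_expectation[of M "\<lambda>n \<omega>. far_prob (c n) a e (T n \<omega>)", OF pr fmeas]
    by (simp add: far_prob_bounds Efar)
  have "AE \<omega> in M n. 0 \<le> cond_prob_given_tree (M n) (T n) (A n e) \<omega>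
      \<and> cond_prob_given_tree (M n) (T n) (A n e) \<omega> \<le> 1" for n e
    using ce[of n e] by eventually_elim (simp add: far_prob_bounds)
  then have cond: "conv_in_prob euclidean M (\<lambda>n. cond_prob_given_tree (M n) (T n) (A n e)) 0
      \<longleftrightarrow> (\<lambda>n. measure (M n) (A n e)) \<longlonglongrightarrow> 0" for e
    using conv_in_prob_zero_iff_expectation[of M "\<lambda>n. cond_prob_given_tree (M n) (T n) (A n e)", OF pr cmeas]
    by (simp add: Ecp)
  have "conv_trees \<longleftrightarrow> (\<forall>e>0. (\<lambda>n. measure (M n) (A n e)) \<longlonglongrightarrow> 0)"
    unfolding conv_trees_def using conv_in_prob_tree_sampling_iff[of M T c a, OF pr T] by (simp add: far)
  moreover have "conv_cond \<longleftrightarrow> (\<forall>e>0. (\<lambda>n. measure (M n) (A n e)) \<longlonglongrightarrow> 0)"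
    unfolding conv_cond_def A_def[symmetric] by (simp add: cond)
  \<comment> \<open>Here no expectation intervenes: \<open>A n e\<close> is already the deviation
    event in the metric form of convergence in probability.\<close>
  moreover have "conv_dist \<longleftrightarrow> (\<forall>e>0. (\<lambda>n. measure (M n) (A n e)) \<longlonglongrightarrow> 0)"
    unfolding conv_dist_def using conv_in_prob_metric[of M D, OF pr Dmeas] by (simp add: A_def dist_real_def)
  ultimately show ?thesis by simp
qed

end
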